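(* Let $V = [v_1, \ldots, v_q] \in \mathbb{R}^{m \times q}$ be a matrix whose columns are the $q$ vertices of the convex hull of a finite set of data points in $\mathbb{R}^m$, let $k$ be a positive integer with $k < q$, let $I$ be the $q \times q$ identity matrix, and let $B \in \mathbb{R}^{q \times k}$ and $A \in \mathbb{R}^{k \times q}$ be column stochastic matrices. Then $$\lVert V(I - BA) \rVert^2 \leq 2q \, \lVert V \rVert^2.$$
   Context: All matrices are real and $\lVert M \rVert$ denotes the Frobenius norm, $\lVert M \rVert^2 = \sum_{i,j} m_{ij}^2$. A matrix is column stochastic if each of its columns has nonnegative entries summing to $1$. The vertices of the convex hull of a finite set are its extreme points. *)

theory Defs
  imports "HOL-Analysis.Analysis"
begin

definition frobenius_norm :: "real ^ 'n ^ 'm \<Rightarrow> real" where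
  "frobenius_norm M = sqrt (\<Sum>i\<in>UNIV. \<Sum>j\<in>UNIV. (M $ i $ j)\<^sup>2)"

lemma frobenius_norm_eq_norm: "frobenius_norm M = norm M"
  by (simp add: frobenius_norm_def norm_vec_def L2_set_def sum_nonneg)

definition column_stochastic :: "real ^ 'n ^ 'm \<Rightarrow> bool" where
  "column_stochastic M \<longleftrightarrow>
     (\<forall>j. (\<forall>i. 0 \<le> M $ i $ j) \<and> (\<Sum>i\<in>UNIV. M $ i $ j) = 1)"

definition hull_vertex_matrix :: "(real ^ 'm) set \<Rightarrow> real ^ 'q ^ 'm \<Rightarrow> bool" where
  "hull_vertex_matrix S V \<longleftrightarrow>
     bij_betw (\<lambda>j. column j V) UNIV {x. x extreme_point_of (convex hull S)}"

end

theory Submission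
  imports Defs
begin

text \<open>
  Put \<open>P = B ** A\<close>, which is again column stochastic. Since the weights in column \<open>j\<close> of \<open>P\<close>
  sum to one, column \<open>j\<close> of \<open>V (I - P)\<close> is the weighted mean of the differences \<open>v\<^sub>j - v\<^sub>i\<close>, with
  weights \<open>P\<^sub>i\<^sub>j\<close>, so its norm is at most the largest \<open>\<parallel>v\<^sub>j - v\<^sub>i\<parallel>\<close>. The parallelogram inequality gives
  \<open>\<parallel>v\<^sub>j - v\<^sub>i\<parallel>\<^sup>2 \<le> 2 (\<parallel>v\<^sub>j\<parallel>\<^sup>2 + \<parallel>v\<^sub>i\<parallel>\<^sup>2) \<le> 2 \<parallel>V\<parallel>\<^sup>2\<close>, because for \<open>i \<noteq> j\<close> the two columns are
  distinct summands of \<open>\<parallel>V\<parallel>\<^sup>2\<close>, and for \<open>i = j\<close> the difference vanishes. Summing over the \<open>q\<close>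
  columns gives the factor \<open>2 q\<close>. Comparing \<open>v\<^sub>j\<close> with the mean \<open>\<Sum>\<^sub>i P\<^sub>i\<^sub>j v\<^sub>i\<close> itself, instead of with
  each \<open>v\<^sub>i\<close>, would bound a column's squared norm by \<open>2 \<parallel>v\<^sub>j\<parallel>\<^sup>2 + 2 \<parallel>V\<parallel>\<^sup>2\<close>, which
  only yields \<open>2 (q + 1)\<close>.
\<close>

lemma norm_matrix_sq_columns:
  fixes M :: "real ^ 'n ^ 'm"
  shows "(norm M)\<^sup>2 = (\<Sum>j\<in>UNIV. (norm (column j M))\<^sup>2)"
proof -
  have "(norm M)\<^sup>2 = (\<Sum>i\<in>UNIV. \<Sum>j\<in>UNIV. (M $ i $ j)\<^sup>2)"
    by (simp add: norm_vec_def L2_set_def sum_nonneg)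
  also have "\<dots> = (\<Sum>j\<in>UNIV. \<Sum>i\<in>UNIV. (M $ i $ j)\<^sup>2)"
    by (rule sum.swap)
  also have "\<dots> = (\<Sum>j\<in>UNIV. (norm (column j M))\<^sup>2)"
    by (simp add: norm_vec_def L2_set_def sum_nonneg column_def)
  finally show ?thesis .
qed

lemma column_stochastic_mult:
  assumes B: "column_stochastic B" and A: "column_stochastic A"
  shows "column_stochastic (B ** A)"
  unfolding column_stochastic_def
proof (intro allI conjI)
  fix i j
  show "0 \<le> (B ** A) $ i $ j"
    using A B by (auto simp: column_stochastic_def matrix_matrix_mult_def intro!: sum_nonneg)
  have "(\<Sum>i\<in>UNIV. (B ** A) $ i $ j) = (\<Sum>l\<in>UNIV. \<Sum>i\<in>UNIV. B $ i $ l * A $ l $ j)"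
    by (simp add: matrix_matrix_mult_def) (rule sum.swap)
  also have "\<dots> = (\<Sum>l\<in>UNIV. A $ l $ j)"
    using B by (simp add: column_stochastic_def flip: sum_distrib_right)
  finally show "(\<Sum>i\<in>UNIV. (B ** A) $ i $ j) = 1"
    using A by (simp add: column_stochastic_def)
qed

text \<open>
  The mean \<open>\<Sum>\<^sub>i P\<^sub>i\<^sub>j v\<^sub>i\<close> is subtracted from \<open>v\<^sub>j = \<Sum>\<^sub>i P\<^sub>i\<^sub>j v\<^sub>j\<close>; this rewriting is where the column
  sums being one enters.
\<close>
lemma column_mult_id_minus_stochastic:
  fixes V :: "real ^ 'q ^ 'm" and P :: "real ^ 'q ^ 'q"
  assumes "column_stochastic P"
  shows "column j (V ** (mat 1 - P))
           = (\<Sum>i\<in>UNIV. P $ i $ j *\<^sub>R (column j V - column i V))"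
proof -
  have sum1: "(\<Sum>i\<in>UNIV. P $ i $ j) = 1"
    using assms by (simp add: column_stochastic_def)
  have "(V ** (mat 1 - P)) $ r $ j = (\<Sum>i\<in>UNIV. P $ i $ j * (V $ r $ j - V $ r $ i))" for r
  proof -
    have "V ** (mat 1 - P) = V ** mat 1 - V ** P"
      by (simp add: vec_eq_iff matrix_matrix_mult_def right_diff_distrib sum_subtractf)
    then have "(V ** (mat 1 - P)) $ r $ j = V $ r $ j - (V ** P) $ r $ j"
      by simp
    also have "V $ r $ j = (\<Sum>i\<in>UNIV. P $ i $ j * V $ r $ j)"
      using sum1 by (simp flip: sum_distrib_right)
    finally show ?thesis
      by (simp add: matrix_matrix_mult_def right_diff_distrib sum_subtractf mult.commute)
  qed
  then show ?thesis
    by (simp add: vec_eq_iff column_def)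
qed

lemma norm_column_diff_sq_le:
  fixes V :: "real ^ 'q ^ 'm"
  shows "(norm (column j V - column i V))\<^sup>2 \<le> 2 * (norm V)\<^sup>2"
proof (cases "i = j")
  case False
  let ?v = "column j V" and ?w = "column i V"
  have "(norm (?v - ?w))\<^sup>2 + (norm (?v + ?w))\<^sup>2 = 2 * ((norm ?v)\<^sup>2 + (norm ?w)\<^sup>2)"
    by (simp add: power2_norm_eq_inner inner_add_left inner_add_right inner_diff_left
        inner_diff_right)
  then have "(norm (?v - ?w))\<^sup>2 \<le> 2 * ((norm ?v)\<^sup>2 + (norm ?w)\<^sup>2)"
    by (smt (verit) zero_le_power2)
  also have "(norm ?v)\<^sup>2 + (norm ?w)\<^sup>2 = (\<Sum>l\<in>{i, j}. (norm (column l V))\<^sup>2)"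
    using False by simp
  also have "\<dots> \<le> (norm V)\<^sup>2"
    unfolding norm_matrix_sq_columns by (intro sum_mono2) auto
  finally show ?thesis by simp
qed simp

lemma norm_column_mult_id_minus_stochastic_sq_le:
  fixes V :: "real ^ 'q ^ 'm" and P :: "real ^ 'q ^ 'q"
  assumes P: "column_stochastic P"
  shows "(norm (column j (V ** (mat 1 - P))))\<^sup>2 \<le> 2 * (norm V)\<^sup>2"
proof -
  have nonneg: "0 \<le> P $ i $ j" for i
    using P by (simp add: column_stochastic_def)
  have diff: "norm (column j V - column i V) \<le> sqrt (2 * (norm V)\<^sup>2)" for i
    by (intro real_le_rsqrt norm_column_diff_sq_le)
  have "norm (column j (V ** (mat 1 - P)))
          \<le> (\<Sum>i\<in>UNIV. norm (P $ i $ j *\<^sub>R (column j V - column i V)))"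
    unfolding column_mult_id_minus_stochastic[OF P] by (rule norm_sum)
  also have "\<dots> \<le> (\<Sum>i\<in>UNIV. P $ i $ j * sqrt (2 * (norm V)\<^sup>2))"
    using nonneg by (intro sum_mono) (simp only: norm_scaleR abs_of_nonneg mult_left_mono diff)
  also have "\<dots> = sqrt (2 * (norm V)\<^sup>2)"
    using P by (simp add: column_stochastic_def flip: sum_distrib_right)
  finally have "(norm (column j (V ** (mat 1 - P))))\<^sup>2 \<le> (sqrt (2 * (norm V)\<^sup>2))\<^sup>2"
    by (rule power_mono) simp
  then show ?thesis
    by (simp only: real_sqrt_pow2 mult_nonneg_nonneg zero_le_power2 zero_le_numeral)
qed

theorem mainTheorem3:
  fixes S :: "(real ^ 'm) set"
    and V :: "real ^ 'q ^ 'm"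
    and B :: "real ^ 'k ^ 'q"
    and A :: "real ^ 'q ^ 'k"
  assumes "finite S"
    and "hull_vertex_matrix S V"
    and "CARD('k) < CARD('q)"
    and "column_stochastic B"
    and "column_stochastic A"
  shows "(frobenius_norm (V ** (mat 1 - B ** A)))\<^sup>2
           \<le> 2 * real CARD('q) * (frobenius_norm V)\<^sup>2"
proof -
  have P: "column_stochastic (B ** A)"
    using assms by (intro column_stochastic_mult)
  have "(norm (V ** (mat 1 - B ** A)))\<^sup>2
          = (\<Sum>j\<in>UNIV. (norm (column j (V ** (mat 1 - B ** A))))\<^sup>2)"
    by (rule norm_matrix_sq_columns)
  also have "\<dots> \<le> (\<Sum>j\<in>(UNIV :: 'q set). 2 * (norm V)\<^sup>2)"
    by (intro sum_mono norm_column_mult_id_minus_stochastic_sq_le P)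
  also have "\<dots> = 2 * real CARD('q) * (norm V)\<^sup>2"
    by simp
  finally show ?thesis
    by (simp only: frobenius_norm_eq_norm)
qed

end
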